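(* For every finite graph $G$, $C^0_G=1+r(A_G)$, where $r(A_G)$ is the spectral radius (equal to the largest eigenvalue) of the adjacency matrix $A_G$ of $G$. Moreover, $DM^0(G)=\{\mu: C^0_\mu=C^0_G\}$ consists exactly of the positive multiples of the measure $\mu_0$ given by $\mu_0(v)=x_v$, where $x=(x_v)_{v\in V_G}$ is the (entrywise positive) Perron eigenvector of $A_G$ for the eigenvalue $r(A_G)$.
   Context: A graph is a locally finite, undirected, connected, simple graph $G$ with vertex set $V_G$ and edge set $E_G$, with path distance $d_G$ and closed balls $B(v,r)=\{w: d_G(v,w)\le r\}$. A measure on $G$ is a function $\mu:V_G\to(0,\infty)$, $\mu(A)=\sum_{v\in A}\mu(v)$; on a finite graph every measure is doubling. For a measure $\mu$, $C^0_\mu=\sup_{v\in V_G}\mu(B(v,1))/\mu(\{v\})$, and $C^0_G=\inf_\mu C^0_\mu$ over all (doubling) measures on $G$. The adjacency matrix $A_G$ is indexed by $V_G\times V_G$ with entry $1$ if $\{v,w\}\in E_G$ and $0$ otherwise. *)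

theory Defs
  imports "Jordan_Normal_Form.Spectral_Radius" "HOL-Library.Extended_Real" "HOL-Library.FuncSet"
begin

definition graph_path :: "'a set \<Rightarrow> 'a set set \<Rightarrow> 'a list \<Rightarrow> bool" where
  "graph_path V E p \<longleftrightarrow> p \<noteq> [] \<and> set p \<subseteq> V \<and> successively (\<lambda>u v. {u, v} \<in> E) p"

locale graph =
  fixes V :: "'a set" and E :: "'a set set"
  assumes nonempty: "V \<noteq> {}"
    and simple: "e \<in> E \<Longrightarrow> e \<subseteq> V \<and> card e = 2"
    and locally_finite: "v \<in> V \<Longrightarrow> finite {w. {v, w} \<in> E}"
    and connected: "u \<in> V \<Longrightarrow> v \<in> V \<Longrightarrow> \<exists>p. graph_path V E p \<and> hd p = u \<and> last p = v"

text \<open>A path with \<open>n + 1\<close> vertices has length \<open>n\<close>. The value is meaningful only for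
  vertices joined by a path, hence for all vertices of a (connected) graph.\<close>
definition graph_dist :: "'a set \<Rightarrow> 'a set set \<Rightarrow> 'a \<Rightarrow> 'a \<Rightarrow> nat" where
  "graph_dist V E u v =
     (LEAST n. \<exists>p. graph_path V E p \<and> hd p = u \<and> last p = v \<and> length p = Suc n)"

definition graph_ball :: "'a set \<Rightarrow> 'a set set \<Rightarrow> 'a \<Rightarrow> real \<Rightarrow> 'a set" where
  "graph_ball V E v r = {w \<in> V. real (graph_dist V E v w) \<le> r}"

text \<open>Measures are extensional functions (\<open>undefined\<close> off \<open>V\<close>), so that two measures are
  equal as soon as they agree on \<open>V\<close>. The measure of a finite vertex set \<open>A\<close> is \<open>sum \<mu> A\<close>;
  balls are finite by local finiteness.\<close>
definition measures_on :: "'a set \<Rightarrow> ('a \<Rightarrow> real) set" where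
  "measures_on V = V \<rightarrow>\<^sub>E {0<..}"

definition doubling :: "'a set \<Rightarrow> 'a set set \<Rightarrow> ('a \<Rightarrow> real) \<Rightarrow> bool" where
  "doubling V E \<mu> \<longleftrightarrow>
     (\<exists>C. \<forall>v\<in>V. \<forall>r>0. sum \<mu> (graph_ball V E v (2 * r)) \<le> C * sum \<mu> (graph_ball V E v r))"

definition doubling_measures :: "'a set \<Rightarrow> 'a set set \<Rightarrow> ('a \<Rightarrow> real) set" where
  "doubling_measures V E = {\<mu> \<in> measures_on V. doubling V E \<mu>}"

definition C0_measure :: "'a set \<Rightarrow> 'a set set \<Rightarrow> ('a \<Rightarrow> real) \<Rightarrow> ereal" where
  "C0_measure V E \<mu> = (SUP v\<in>V. ereal (sum \<mu> (graph_ball V E v 1) / \<mu> v))"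

definition C0_graph :: "'a set \<Rightarrow> 'a set set \<Rightarrow> ereal" where
  "C0_graph V E = (INF \<mu>\<in>doubling_measures V E. C0_measure V E \<mu>)"

definition DM0 :: "'a set \<Rightarrow> 'a set set \<Rightarrow> ('a \<Rightarrow> real) set" where
  "DM0 V E = {\<mu> \<in> doubling_measures V E. C0_measure V E \<mu> = C0_graph V E}"

text \<open>Matrices are indexed by initial segments of the natural numbers, so the vertices are
  listed without repetition as \<open>vs\<close>, and row and column \<open>i\<close> belong to the vertex \<open>vs ! i\<close>.\<close>
definition adjacency_matrix :: "'a set set \<Rightarrow> 'a list \<Rightarrow> real mat" where
  "adjacency_matrix E vs =
     mat (length vs) (length vs) (\<lambda>(i, j). if {vs ! i, vs ! j} \<in> E then 1 else 0)"

text \<open>\<^const>\<open>spectral_radius\<close> is defined for complex matrices: it is the largest modulus of a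
  complex eigenvalue.\<close>
definition real_spectral_radius :: "real mat \<Rightarrow> real" where
  "real_spectral_radius A = spectral_radius (map_mat complex_of_real A)"

definition perron_eigenvector :: "real mat \<Rightarrow> real vec \<Rightarrow> bool" where
  "perron_eigenvector A x \<longleftrightarrow>
     eigenvector A x (real_spectral_radius A) \<and> (\<forall>i < dim_vec x. 0 < x $ i)"

end

theory Submission
  imports Defs "HOL-Analysis.Function_Topology"
begin

text \<open>
  A maximiser of the quadratic form of the adjacency matrix \<open>A\<close> over nonnegative unit vectors is,
  by connectedness, a positive eigenvector \<open>x\<close>, with eigenvalue \<open>\<rho>\<close> say. As \<open>A\<close> is symmetric,
  pairing with \<open>x\<close> shows that \<open>c y \<le> A y\<close> with \<open>y \<ge> 0\<close> nonzero forces \<open>c \<le> \<rho>\<close>, and that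
  \<open>A y \<le> \<rho> y\<close> forces \<open>A y = \<rho> y\<close>. The former, applied to the moduli of a complex eigenvector,
  identifies \<open>\<rho>\<close> with the spectral radius. Since \<open>\<mu>(B(v,1))/\<mu>(v) = 1 + (A \<mu>)(v)/\<mu>(v)\<close>, the
  latter gives \<open>C\<^sup>0 \<ge> 1 + \<rho>\<close>, with equality exactly when \<open>\<mu>\<close> is an eigenvector for \<open>\<rho>\<close>.
\<close>

section \<open>Perron--Frobenius theory of irreducible symmetric kernels\<close>

text \<open>Irreducibility is phrased by closed sets rather than by paths or matrix powers: this is
  the form in which zeros of eigenfunctions are propagated.\<close>

locale irreducible_kernel =
  fixes V :: "'a set" and a :: "'a \<Rightarrow> 'a \<Rightarrow> real"
  assumes finite_V: "finite V"
    and V_nonempty: "V \<noteq> {}"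
    and nonneg: "0 \<le> a v w"
    and sym: "a v w = a w v"
    and irreducible:
      "\<lbrakk>Z \<subseteq> V; Z \<noteq> {}; \<And>v w. \<lbrakk>v \<in> Z; w \<in> V; 0 < a v w\<rbrakk> \<Longrightarrow> w \<in> Z\<rbrakk> \<Longrightarrow> Z = V"
begin

definition app :: "('a \<Rightarrow> real) \<Rightarrow> 'a \<Rightarrow> real" where
  "app f v = (\<Sum>w\<in>V. a v w * f w)"

definition eigenfunction :: "real \<Rightarrow> ('a \<Rightarrow> real) \<Rightarrow> bool" where
  "eigenfunction c f \<longleftrightarrow> (\<forall>v\<in>V. app f v = c * f v)"

definition perron :: "real \<Rightarrow> ('a \<Rightarrow> real) \<Rightarrow> bool" where
  "perron c f \<longleftrightarrow> eigenfunction c f \<and> (\<forall>v\<in>V. 0 < f v)"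

lemma app_selfadjoint: "(\<Sum>v\<in>V. g v * app f v) = (\<Sum>v\<in>V. app g v * f v)"
proof -
  have "(\<Sum>v\<in>V. g v * app f v) = (\<Sum>v\<in>V. \<Sum>w\<in>V. g v * (a v w * f w))"
    by (simp add: app_def sum_distrib_left)
  also have "\<dots> = (\<Sum>w\<in>V. \<Sum>v\<in>V. g v * (a v w * f w))"
    by (rule sum.swap)
  also have "\<dots> = (\<Sum>w\<in>V. app g w * f w)"
    unfolding app_def sum_distrib_right
    by (intro sum.cong refl) (metis sym mult.assoc mult.commute)
  finally show ?thesis .
qed

lemma app_add_scaled: "app (\<lambda>v. f v + t * g v) v = app f v + t * app g v"
  by (simp add: app_def sum.distrib sum_distrib_left algebra_simps)

lemma eigenfunction_diff_scaled:
  assumes "eigenfunction c f" "eigenfunction c g"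
  shows "eigenfunction c (\<lambda>v. f v - t * g v)"
proof -
  have "app (\<lambda>v. f v - t * g v) v = app f v - t * app g v" for v
    using app_add_scaled[of f "- t" g v] by simp
  then show ?thesis
    using assms by (simp add: eigenfunction_def right_diff_distrib mult.left_commute)
qed

text \<open>At a zero of \<open>f\<close> the nonnegative terms \<open>a v w * f w\<close> sum to
  zero, so \<open>f\<close> vanishes at every \<open>w\<close> with \<open>0 < a v w\<close>. The
  zero set is therefore closed in the sense of \<open>irreducible\<close>.\<close>

lemma nonneg_eigenfunction_zero:
  assumes f: "eigenfunction c f" and ge: "\<And>v. v \<in> V \<Longrightarrow> 0 \<le> f v"
    and z: "z \<in> V" "f z = 0" and v: "v \<in> V"
  shows "f v = 0"
proof -
  have "{v\<in>V. f v = 0} = V"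
  proof (rule irreducible)
    fix v w assume v: "v \<in> {v\<in>V. f v = 0}" and w: "w \<in> V" "0 < a v w"
    have "(\<Sum>w\<in>V. a v w * f w) = 0"
      using f v by (auto simp: eigenfunction_def app_def)
    then have "a v w * f w = 0"
      using sum_nonneg_eq_0_iff[OF finite_V, of "\<lambda>w. a v w * f w"] ge nonneg w(1)
      by (metis mult_nonneg_nonneg)
    then show "w \<in> {v\<in>V. f v = 0}" using w by simp
  qed (use z in auto)
  then show ?thesis using v by blast
qed

section \<open>Existence of a positive eigenfunction by maximising the quadratic form\<close>

abbreviation quad :: "('a \<Rightarrow> real) \<Rightarrow> real" where
  "quad f \<equiv> (\<Sum>v\<in>V. f v * app f v)"

text \<open>A maximum over nonnegative unit functions exists by compactness. It bounds
  \<open>quad g\<close> for every \<open>g\<close>, since passing to absolute values cannot lower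
  the form and both sides scale quadratically.\<close>

lemma quad_maximum:
  obtains f where "\<And>v. v \<in> V \<Longrightarrow> 0 \<le> f v" "(\<Sum>v\<in>V. (f v)\<^sup>2) = 1"
    "\<And>g. quad g \<le> quad f * (\<Sum>v\<in>V. (g v)\<^sup>2)"
proof -
  \<comment> \<open>Fixing the value 0 off \<open>V\<close> makes every factor compact, so Tychonoff
    applies even if the vertex type is infinite.\<close>
  define B where "B = (\<Pi>\<^sub>E v\<in>UNIV. if v \<in> V then {0..1} else {0::real})"
  define S where "S = {f :: 'a \<Rightarrow> real. (\<Sum>v\<in>V. (f v)\<^sup>2) = 1}"
  have cont: "continuous_on A (\<lambda>f :: 'a \<Rightarrow> real. f v)" for v A
    by (rule continuous_on_subset[OF continuous_on_product_coordinates subset_UNIV])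
  have "compactin (product_topology (\<lambda>_. euclidean) UNIV) B"
    unfolding B_def compactin_PiE by (auto simp: compactin_euclidean_iff)
  then have "compact B"
    by (simp add: euclidean_product_topology compactin_euclidean_iff)
  moreover have "closed S"
    unfolding S_def by (intro closed_Collect_eq continuous_intros cont)
  ultimately have compact: "compact (B \<inter> S)" by (rule compact_Int_closed)
  have quad: "continuous_on (B \<inter> S) quad"
    unfolding app_def by (intro continuous_intros cont)
  obtain u where u: "u \<in> V" using V_nonempty by blast
  have "(\<lambda>v. if v = u then 1 else 0) \<in> B \<inter> S"
    using u finite_V by (auto simp: B_def S_def if_distrib[of "\<lambda>x. x\<^sup>2"] cong: if_cong)
  then have "B \<inter> S \<noteq> {}" by blast
  from continuous_attains_sup[OF compact this quad]
  obtain f where f: "f \<in> B \<inter> S" and max: "\<And>g. g \<in> B \<inter> S \<Longrightarrow> quad g \<le> quad f"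
    by auto
  have f0: "0 \<le> f v" if "v \<in> V" for v
    using f that by (auto simp: B_def dest: PiE_mem[of _ _ _ v])
  have f1: "(\<Sum>v\<in>V. (f v)\<^sup>2) = 1" using f by (simp add: S_def)
  have "quad g \<le> quad f * (\<Sum>v\<in>V. (g v)\<^sup>2)" for g
  proof -
    define N where "N = (\<Sum>v\<in>V. (g v)\<^sup>2)"
    have N0: "0 \<le> N" by (simp add: N_def sum_nonneg)
    show ?thesis
    proof (cases "N = 0")
      case True
      then have "g v = 0" if "v \<in> V" for v
        using that finite_V by (simp add: N_def sum_nonneg_eq_0_iff)
      then show ?thesis by simp
    next
      case False
      define h where "h v = (if v \<in> V then \<bar>g v\<bar> / sqrt N else 0)" for v
      have sq: "sqrt N * sqrt N = N" using N0 by simp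
      have "(g v)\<^sup>2 \<le> N" if "v \<in> V" for v
        unfolding N_def using member_le_sum[OF that, of "\<lambda>v. (g v)\<^sup>2"] finite_V by simp
      then have "\<bar>g v\<bar> \<le> sqrt N" if "v \<in> V" for v
        using that by (simp add: real_le_rsqrt)
      then have "h \<in> B" using False N0
        by (auto simp: B_def h_def divide_simps)
      moreover have "(\<Sum>v\<in>V. (h v)\<^sup>2) = 1"
      proof -
        have "(\<Sum>v\<in>V. (h v)\<^sup>2) = (\<Sum>v\<in>V. (g v)\<^sup>2 / N)"
          using N0 by (intro sum.cong) (auto simp: h_def power_divide)
        then show ?thesis using False by (simp add: sum_divide_distrib[symmetric] N_def)
      qed
      ultimately have le: "quad h \<le> quad f" by (intro max) (simp add: S_def)
      have "quad g \<le> (\<Sum>v\<in>V. \<Sum>w\<in>V. a v w * \<bar>g v\<bar> * \<bar>g w\<bar>)"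
        unfolding app_def sum_distrib_left
      proof (intro sum_mono)
        fix v w
        have "g v * (a v w * g w) \<le> \<bar>g v * (a v w * g w)\<bar>" by simp
        also have "\<dots> = a v w * \<bar>g v\<bar> * \<bar>g w\<bar>" using nonneg[of v w] by (simp add: abs_mult)
        finally show "g v * (a v w * g w) \<le> a v w * \<bar>g v\<bar> * \<bar>g w\<bar>" .
      qed
      also have "\<dots> = N * quad h"
        unfolding app_def sum_distrib_left
      proof (intro sum.cong refl)
        fix v w assume "v \<in> V" "w \<in> V"
        then have "\<bar>g v\<bar> = sqrt N * h v" "\<bar>g w\<bar> = sqrt N * h w"
          using False by (simp_all add: h_def)
        then have "a v w * \<bar>g v\<bar> * \<bar>g w\<bar> = (sqrt N * sqrt N) * (h v * (a v w * h w))"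
          by (simp only: mult_ac)
        then show "a v w * \<bar>g v\<bar> * \<bar>g w\<bar> = N * (h v * (a v w * h w))"
          by (simp only: sq)
      qed
      also have "\<dots> \<le> N * quad f" using le N0 by (rule mult_left_mono)
      finally show ?thesis by (simp add: N_def mult.commute)
    qed
  qed
  with f0 f1 show thesis by (rule that)
qed

text \<open>The form \<open>\<rho> \<parallel>g\<parallel>\<^sup>2 - quad g\<close> is positive semidefinite and vanishes at the maximiser, so the
  maximiser lies in its kernel.\<close>
lemma perron_exists: obtains \<rho> x where "perron \<rho> x"
proof -
  obtain f where f0: "\<And>v. v \<in> V \<Longrightarrow> 0 \<le> f v" and f1: "(\<Sum>v\<in>V. (f v)\<^sup>2) = 1"
    and max: "\<And>g. quad g \<le> quad f * (\<Sum>v\<in>V. (g v)\<^sup>2)"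
    using quad_maximum by blast
  define \<rho> where "\<rho> = quad f"
  define d where "d v = \<rho> * f v - app f v" for v
  define D where "D = (\<Sum>v\<in>V. (d v)\<^sup>2)"
  \<comment> \<open>Expand the semidefinite form at \<open>f + t * d\<close>: the constant term
    vanishes as \<open>f\<close> has norm 1, the linear coefficient is \<open>2 * D\<close> by
    self-adjointness, and the quadratic one is \<open>P\<close>.\<close>
  define P where "P = \<rho> * (\<Sum>v\<in>V. (d v)\<^sup>2) - quad d"
  have pos: "0 \<le> 2 * t * D + t\<^sup>2 * P" for t
  proof -
    have cross: "(\<Sum>v\<in>V. f v * app d v) = (\<Sum>v\<in>V. d v * app f v)"
      using app_selfadjoint[of f d] by (simp add: mult.commute)
    have q: "quad (\<lambda>v. f v + t * d v) = \<rho> + 2 * t * (\<Sum>v\<in>V. d v * app f v) + t\<^sup>2 * quad d"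
    proof -
      have "(f v + t * d v) * app (\<lambda>v. f v + t * d v) v = f v * app f v
          + t * (f v * app d v) + t * (d v * app f v) + t\<^sup>2 * (d v * app d v)" for v
        unfolding app_add_scaled by (simp add: algebra_simps power2_eq_square)
      then have "quad (\<lambda>v. f v + t * d v) = quad f + t * (\<Sum>v\<in>V. f v * app d v)
          + t * (\<Sum>v\<in>V. d v * app f v) + t\<^sup>2 * quad d"
        by (simp only: sum.distrib sum_distrib_left)
      then show ?thesis unfolding cross \<rho>_def by simp
    qed
    have n: "(\<Sum>v\<in>V. (f v + t * d v)\<^sup>2) = 1 + 2 * t * (\<Sum>v\<in>V. d v * f v) + t\<^sup>2 * D"
    proof -
      have "(f v + t * d v)\<^sup>2 = (f v)\<^sup>2 + 2 * t * (d v * f v) + t\<^sup>2 * (d v)\<^sup>2" for v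
        by (simp add: algebra_simps power2_eq_square)
      then show ?thesis
        by (simp only: sum.distrib sum_distrib_left[symmetric] f1 D_def)
    qed
    have D: "D = \<rho> * (\<Sum>v\<in>V. d v * f v) - (\<Sum>v\<in>V. d v * app f v)"
      unfolding D_def sum_distrib_left sum_subtractf[symmetric]
      by (intro sum.cong refl) (simp add: d_def power2_eq_square algebra_simps)
    have "0 \<le> \<rho> * (\<Sum>v\<in>V. (f v + t * d v)\<^sup>2) - quad (\<lambda>v. f v + t * d v)"
      using max[of "\<lambda>v. f v + t * d v"] by (simp add: \<rho>_def)
    also have "\<dots> = 2 * t * D + t\<^sup>2 * P"
      unfolding q n D P_def D_def[symmetric] by (simp add: algebra_simps D)
    finally show ?thesis .
  qed
  have "D = 0"
  proof (rule ccontr)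
    assume "D \<noteq> 0"
    then have D: "0 < D" unfolding D_def by (simp add: less_le sum_nonneg)
    have P: "0 \<le> P" using max[of d] by (simp add: P_def \<rho>_def)
    \<comment> \<open>A small negative \<open>t\<close> lets the linear term win; adding 1 keeps the
      denominator positive when \<open>P = 0\<close>.\<close>
    define t where "t = - D / (P + 1)"
    have "2 * t * D + t\<^sup>2 * P = - (D\<^sup>2 * (P + 2)) / (P + 1)\<^sup>2"
      using P by (simp add: t_def power2_eq_square divide_simps) (simp add: algebra_simps)
    moreover have "0 < D\<^sup>2 * (P + 2) / (P + 1)\<^sup>2" using D P by simp
    ultimately show False using pos[of t] by simp
  qed
  then have eig: "eigenfunction \<rho> f"
    using finite_V by (simp add: D_def d_def sum_nonneg_eq_0_iff eigenfunction_def)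
  have "f v \<noteq> 0" if "v \<in> V" for v
  proof
    assume "f v = 0"
    then have "f w = 0" if "w \<in> V" for w
      using nonneg_eigenfunction_zero[OF eig f0 \<open>v \<in> V\<close>] that by blast
    then show False using f1 by simp
  qed
  then show thesis using that[of \<rho> f] eig f0 by (force simp: perron_def less_le)
qed

section \<open>Comparison and uniqueness by means of a positive eigenfunction\<close>

lemma perron_pairing:
  assumes "perron \<rho> x"
  shows "(\<Sum>v\<in>V. x v * app y v) = \<rho> * (\<Sum>v\<in>V. x v * y v)"
  unfolding app_selfadjoint[of x y] sum_distrib_left
  using assms by (intro sum.cong) (auto simp: perron_def eigenfunction_def)

lemma perron_pairing_pos:
  assumes "perron \<rho> x" "\<And>v. v \<in> V \<Longrightarrow> 0 \<le> y v" "u \<in> V" "y u \<noteq> 0"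
  shows "0 < (\<Sum>v\<in>V. x v * y v)"
  using assms finite_V by (intro sum_pos2[of V u]) (auto simp: perron_def less_le)

lemma perron_ge:
  assumes x: "perron \<rho> x" and y: "\<And>v. v \<in> V \<Longrightarrow> 0 \<le> y v" "u \<in> V" "y u \<noteq> 0"
    and le: "\<And>v. v \<in> V \<Longrightarrow> c * y v \<le> app y v"
  shows "c \<le> \<rho>"
proof -
  have "c * (\<Sum>v\<in>V. x v * y v) = (\<Sum>v\<in>V. x v * (c * y v))"
    by (simp add: sum_distrib_left algebra_simps)
  also have "\<dots> \<le> (\<Sum>v\<in>V. x v * app y v)"
    using x le by (intro sum_mono mult_left_mono) (auto simp: perron_def less_imp_le)
  finally show ?thesis
    using perron_pairing_pos[where y = y, OF x y] by (simp add: perron_pairing[OF x])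
qed

text \<open>The defect \<open>\<rho> * y v - app y v\<close> is nonnegative, yet its pairing with
  the positive \<open>x\<close> is zero; hence it vanishes at each vertex.\<close>

lemma superharmonic_eigenfunction:
  assumes x: "perron \<rho> x" and le: "\<And>v. v \<in> V \<Longrightarrow> app y v \<le> \<rho> * y v"
  shows "eigenfunction \<rho> y"
proof -
  have "(\<Sum>v\<in>V. x v * (\<rho> * y v - app y v)) = 0"
    using perron_pairing[OF x, of y]
    by (simp add: right_diff_distrib sum_subtractf sum_distrib_left mult.left_commute)
  moreover have "0 \<le> x v * (\<rho> * y v - app y v)" if "v \<in> V" for v
    using that x le by (simp add: perron_def less_imp_le)
  ultimately have "\<forall>v\<in>V. x v * (\<rho> * y v - app y v) = 0"
    using sum_nonneg_eq_0_iff[OF finite_V, of "\<lambda>v. x v * (\<rho> * y v - app y v)"] by simp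
  then show ?thesis using x by (force simp: perron_def eigenfunction_def)
qed

text \<open>Subtract from \<open>y\<close> the largest multiple of \<open>x\<close> that leaves a
  nonnegative function, namely with \<open>c\<close> the minimum of \<open>y v / x v\<close>. The
  difference is an eigenfunction with a zero at the minimiser, so it vanishes on
  \<open>V\<close>.\<close>

lemma perron_unique_up_to_scaling:
  assumes x: "perron \<rho> x" and y: "perron \<rho> y"
  obtains c where "0 < c" "\<And>v. v \<in> V \<Longrightarrow> y v = c * x v"
proof -
  define c where "c = Min ((\<lambda>v. y v / x v) ` V)"
  have "c \<in> (\<lambda>v. y v / x v) ` V" unfolding c_def using finite_V V_nonempty by (intro Min_in) auto
  then obtain z where z: "z \<in> V" "c = y z / x z" by blast
  have le: "c \<le> y v / x v" if "v \<in> V" for v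
    unfolding c_def using finite_V that by (intro Min_le) auto
  have "y v - c * x v = 0" if "v \<in> V" for v
  proof (rule nonneg_eigenfunction_zero[OF _ _ z(1) _ that])
    show "eigenfunction \<rho> (\<lambda>v. y v - c * x v)"
      using x y by (auto simp: perron_def intro: eigenfunction_diff_scaled)
    show "0 \<le> y v - c * x v" if "v \<in> V" for v
      using le[OF that] x that by (simp add: perron_def pos_le_divide_eq)
    show "y z - c * x z = 0" using z x by (force simp: perron_def)
  qed
  moreover have "0 < c" using z x y by (simp add: perron_def)
  ultimately show thesis using that[of c] by simp
qed

text \<open>By the triangle inequality the moduli of \<open>z\<close> satisfy the hypothesis of
  \<open>perron_ge\<close> with \<open>c = cmod k\<close>.\<close>

lemma cmod_eigenvalue_le:
  fixes z :: "'a \<Rightarrow> complex"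
  assumes x: "perron \<rho> x" and u: "u \<in> V" "z u \<noteq> 0"
    and z: "\<And>v. v \<in> V \<Longrightarrow> (\<Sum>w\<in>V. of_real (a v w) * z w) = k * z v"
  shows "cmod k \<le> \<rho>"
proof (rule perron_ge[OF x, of "\<lambda>v. cmod (z v)" u])
  fix v assume "v \<in> V"
  then have "cmod k * cmod (z v) = cmod (\<Sum>w\<in>V. of_real (a v w) * z w)"
    by (simp add: z norm_mult)
  also have "\<dots> \<le> (\<Sum>w\<in>V. cmod (of_real (a v w) * z w))" by (rule norm_sum)
  also have "\<dots> = app (\<lambda>v. cmod (z v)) v"
    by (simp add: app_def norm_mult nonneg)
  finally show "cmod k * cmod (z v) \<le> app (\<lambda>v. cmod (z v)) v" .
qed (use u in auto)

end

section \<open>Unit balls in finite graphs\<close>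

context graph
begin

lemma graph_dist_le_1_iff:
  assumes "v \<in> V" "w \<in> V"
  shows "graph_dist V E v w \<le> 1 \<longleftrightarrow> v = w \<or> {v, w} \<in> E"
proof
  define P where "P n \<longleftrightarrow> (\<exists>p. graph_path V E p \<and> hd p = v \<and> last p = w \<and> length p = Suc n)" for n
  have dist: "graph_dist V E v w = (LEAST n. P n)" by (simp add: graph_dist_def P_def)
  {
    assume le: "graph_dist V E v w \<le> 1"
    obtain p where p: "graph_path V E p" "hd p = v" "last p = w"
      using connected assms by blast
    \<comment> \<open>Connectedness supplies a path, so that the \<open>LEAST\<close> is
      attained.\<close>
    then have "P (length p - 1)" by (auto simp: P_def graph_path_def)
    then have "P (graph_dist V E v w)" unfolding dist by (rule LeastI)
    then obtain q where q: "graph_path V E q" "hd q = v" "last q = w" "length q \<le> 2"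
      using le by (auto simp: P_def)
    then show "v = w \<or> {v, w} \<in> E"
      \<comment> \<open>The rule is borrowed for its three list patterns: empty, singleton, and at
        least two elements.\<close>
      by (cases q rule: remdups_adj.cases) (auto simp: graph_path_def)
  }
  {
    assume "v = w \<or> {v, w} \<in> E"
    then have "P 0 \<or> P 1"
    proof
      assume "v = w"
      then show ?thesis
        using assms by (auto simp: P_def graph_path_def intro!: exI[of _ "[v]"])
    next
      assume "{v, w} \<in> E"
      then have "P 1"
        using assms by (auto simp: P_def graph_path_def intro!: exI[of _ "[v, w]"])
      then show ?thesis ..
    qed
    then show "graph_dist V E v w \<le> 1"
      unfolding dist using Least_le[of P 0] Least_le[of P 1] by auto
  }
qed

text \<open>This turns connectedness by paths into irreducibility of the adjacency kernel.\<close>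

lemma path_last_in_closed_set:
  assumes "graph_path V E p" "hd p \<in> Z"
    and "\<And>v w. \<lbrakk>v \<in> Z; w \<in> V; {v, w} \<in> E\<rbrakk> \<Longrightarrow> w \<in> Z"
  shows "last p \<in> Z"
  using assms(1,2)
proof (induction p)
  case Nil
  then show ?case by (simp add: graph_path_def)
next
  case (Cons u p)
  show ?case
  proof (cases p)
    case Nil
    then show ?thesis using Cons.prems by simp
  next
    case (Cons w q)
    then have "graph_path V E p" "w \<in> V" "{u, w} \<in> E"
      using Cons.prems by (auto simp: graph_path_def)
    then show ?thesis using Cons.IH Cons.prems assms(3)[of u w] Cons by auto
  qed
qed

end

locale finite_graph = graph +
  assumes finite_vertices: "finite V"
begin

sublocale irreducible_kernel V "\<lambda>v w. if {v, w} \<in> E then 1 else 0"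
proof
  fix Z assume Z: "Z \<subseteq> V" "Z \<noteq> {}"
    and closed: "\<And>v w. \<lbrakk>v \<in> Z; w \<in> V; 0 < (if {v, w} \<in> E then 1 else (0::real))\<rbrakk> \<Longrightarrow> w \<in> Z"
  obtain z where z: "z \<in> Z" using Z by blast
  have "v \<in> Z" if v: "v \<in> V" for v
  proof -
    obtain p where "graph_path V E p" "hd p = z" "last p = v"
      using connected[of z v] z Z v by blast
    then show ?thesis using path_last_in_closed_set[of p Z] closed z by auto
  qed
  then show "Z = V" using Z by blast
qed (use finite_vertices nonempty in \<open>auto simp: insert_commute\<close>)

text \<open>The ball consists of \<open>v\<close> and its neighbours; edges have two elements, so
  \<open>v\<close> is not its own neighbour and is counted once.\<close>

lemma sum_unit_ball:
  assumes "v \<in> V"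
  shows "sum \<mu> (graph_ball V E v 1) = \<mu> v + app \<mu> v"
proof -
  have "graph_dist V E v w \<le> 1 \<longleftrightarrow> v = w \<or> {v, w} \<in> E" if "w \<in> V" for w
    using graph_dist_le_1_iff assms that by blast
  then have "graph_ball V E v 1 = insert v {w \<in> V. {v, w} \<in> E}"
    using assms by (auto simp: graph_ball_def)
  moreover have "{v, v} \<notin> E" using simple[of "{v, v}"] by auto
  moreover have "app \<mu> v = sum \<mu> {w \<in> V. {v, w} \<in> E}"
    unfolding app_def using finite_V by (auto simp: sum.inter_filter intro!: sum.cong)
  ultimately show ?thesis using finite_V by simp
qed

text \<open>Finiteness makes doubling automatic: a ball of positive radius has mass at least that of
  its centre, and every ball has at most the total mass.\<close>

lemma doubling_measures_eq: "doubling_measures V E = measures_on V"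
proof -
  have "doubling V E \<mu>" if \<mu>: "\<mu> \<in> measures_on V" for \<mu>
    unfolding doubling_def
  proof (intro exI ballI allI impI)
    fix v and r :: real assume v: "v \<in> V" and r: "0 < r"
    have pos: "0 < \<mu> w" if "w \<in> V" for w
      using \<mu> that by (auto simp: measures_on_def dest: PiE_mem)
    have "graph_dist V E v v = 0"
      unfolding graph_dist_def
      using v by (intro Least_eq_0 exI[of _ "[v]"]) (simp add: graph_path_def)
    then have "v \<in> graph_ball V E v r"
      using v r by (simp add: graph_ball_def)
    moreover have sub: "graph_ball V E v s \<subseteq> V" for s by (auto simp: graph_ball_def)
    ultimately have ge: "\<mu> v \<le> sum \<mu> (graph_ball V E v r)"
      using pos finite_V by (intro member_le_sum) (auto intro: less_imp_le finite_subset)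
    have "sum \<mu> (graph_ball V E v (2 * r)) \<le> sum \<mu> V"
      using pos sub finite_V by (intro sum_mono2) (auto intro: less_imp_le)
    also have "\<dots> = sum \<mu> V / \<mu> v * \<mu> v" using pos[OF v] by simp
    \<comment> \<open>The doubling constant may not depend on \<open>v\<close>, so the ratio at
      \<open>v\<close> is replaced by the sum of the ratios at all vertices.\<close>
    also have "\<dots> \<le> (\<Sum>w\<in>V. sum \<mu> V / \<mu> w) * sum \<mu> (graph_ball V E v r)"
    proof (rule mult_mono[OF _ ge])
      have total: "0 \<le> sum \<mu> V / \<mu> w" if "w \<in> V" for w
        using pos that by (intro divide_nonneg_pos sum_nonneg) (auto intro: less_imp_le)
      show "sum \<mu> V / \<mu> v \<le> (\<Sum>w\<in>V. sum \<mu> V / \<mu> w)"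
        using total v finite_V by (intro member_le_sum) auto
      show "0 \<le> (\<Sum>w\<in>V. sum \<mu> V / \<mu> w)"
        using total by (rule sum_nonneg)
    qed (use pos[OF v] in simp)
    finally show "sum \<mu> (graph_ball V E v (2 * r))
      \<le> (\<Sum>w\<in>V. sum \<mu> V / \<mu> w) * sum \<mu> (graph_ball V E v r)" .
  qed
  then show ?thesis by (auto simp: doubling_measures_def)
qed

section \<open>The constant of a measure against the Perron eigenvalue\<close>

lemma measures_on_pos: "\<lbrakk>\<mu> \<in> measures_on V; v \<in> V\<rbrakk> \<Longrightarrow> 0 < \<mu> v"
  by (auto simp: measures_on_def dest: PiE_mem)

lemma C0_measure_le_iff:
  assumes "\<mu> \<in> measures_on V"
  shows "C0_measure V E \<mu> \<le> ereal (1 + c) \<longleftrightarrow> (\<forall>v\<in>V. app \<mu> v \<le> c * \<mu> v)"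
proof -
  have "(\<mu> v + app \<mu> v) / \<mu> v \<le> 1 + c \<longleftrightarrow> app \<mu> v \<le> c * \<mu> v" if "v \<in> V" for v
    using measures_on_pos[OF assms that] by (simp add: pos_divide_le_eq algebra_simps)
  then show ?thesis by (simp add: C0_measure_def SUP_le_iff sum_unit_ball)
qed

text \<open>If \<open>app \<mu> v < \<rho> * \<mu> v\<close> held at every vertex,
  \<open>superharmonic_eigenfunction\<close> would force equality. So at some vertex the ratio is at
  least \<open>1 + \<rho>\<close>.\<close>

lemma C0_measure_ge:
  assumes x: "perron \<rho> x" and \<mu>: "\<mu> \<in> measures_on V"
  shows "ereal (1 + \<rho>) \<le> C0_measure V E \<mu>"
proof -
  have "\<exists>v\<in>V. \<rho> * \<mu> v \<le> app \<mu> v"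
  proof (rule ccontr)
    assume "\<not> ?thesis"
    then have less: "app \<mu> v < \<rho> * \<mu> v" if "v \<in> V" for v using that by force
    then have "eigenfunction \<rho> \<mu>"
      using superharmonic_eigenfunction[OF x, of \<mu>] by (simp add: less_imp_le)
    then show False using less V_nonempty by (fastforce simp: eigenfunction_def)
  qed
  then obtain v where v: "v \<in> V" "\<rho> * \<mu> v \<le> app \<mu> v" by blast
  have "1 + \<rho> \<le> (\<mu> v + app \<mu> v) / \<mu> v"
    using v measures_on_pos[OF \<mu> v(1)] by (simp add: pos_le_divide_eq algebra_simps)
  then show ?thesis
    unfolding C0_measure_def
    by (intro SUP_upper2[OF v(1)]) (simp add: sum_unit_ball v(1))
qed

text \<open>Given the lower bound, equality amounts to
  \<open>app \<mu> v \<le> \<rho> * \<mu> v\<close> on \<open>V\<close>, which is rigid.\<close>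

lemma C0_measure_eq_iff:
  assumes x: "perron \<rho> x" and \<mu>: "\<mu> \<in> measures_on V"
  shows "C0_measure V E \<mu> = ereal (1 + \<rho>) \<longleftrightarrow> perron \<rho> \<mu>"
proof -
  have "C0_measure V E \<mu> = ereal (1 + \<rho>) \<longleftrightarrow> C0_measure V E \<mu> \<le> ereal (1 + \<rho>)"
    using C0_measure_ge[OF x \<mu>] by auto
  also have "\<dots> \<longleftrightarrow> eigenfunction \<rho> \<mu>"
    unfolding C0_measure_le_iff[OF \<mu>]
    using superharmonic_eigenfunction[OF x, of \<mu>] by (auto simp: eigenfunction_def)
  finally show ?thesis using measures_on_pos[OF \<mu>] by (simp add: perron_def)
qed

lemma C0_graph_eq:
  assumes x: "perron \<rho> x"
  shows "C0_graph V E = ereal (1 + \<rho>)"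
proof (rule antisym)
  \<comment> \<open>Measures are extensional, whereas \<open>x\<close> is arbitrary off
    \<open>V\<close>; \<open>app\<close> reads only values on \<open>V\<close>, so restricting
    preserves \<open>perron\<close>.\<close>
  have x': "restrict x V \<in> measures_on V"
    using x by (auto simp: measures_on_def perron_def)
  have "perron \<rho> (restrict x V)"
    using x by (simp add: perron_def eigenfunction_def app_def)
  then show "C0_graph V E \<le> ereal (1 + \<rho>)"
    unfolding C0_graph_def doubling_measures_eq
    using C0_measure_eq_iff[OF x x'] by (intro INF_lower2[OF x']) simp
  show "ereal (1 + \<rho>) \<le> C0_graph V E"
    unfolding C0_graph_def doubling_measures_eq
    using C0_measure_ge[OF x] by (intro INF_greatest)
qed

lemma perron_iff_multiple:
  assumes x: "perron \<rho> x"
  shows "perron \<rho> \<mu> \<longleftrightarrow> (\<exists>c>0. \<forall>v\<in>V. \<mu> v = c * x v)"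
proof
  assume "perron \<rho> \<mu>"
  then show "\<exists>c>0. \<forall>v\<in>V. \<mu> v = c * x v"
    using perron_unique_up_to_scaling[OF x] by metis
next
  assume "\<exists>c>0. \<forall>v\<in>V. \<mu> v = c * x v"
  then obtain c where c: "0 < c" "\<And>v. v \<in> V \<Longrightarrow> \<mu> v = c * x v" by blast
  have "app \<mu> v = c * app x v" for v
    unfolding app_def sum_distrib_left by (intro sum.cong) (auto simp: c(2))
  then show "perron \<rho> \<mu>"
    using x c by (simp add: perron_def eigenfunction_def mult.left_commute)
qed

lemma DM0_eq:
  assumes x: "perron \<rho> x"
  shows "DM0 V E = {\<mu> \<in> measures_on V. \<exists>c>0. \<forall>v\<in>V. \<mu> v = c * x v}"
  using C0_measure_eq_iff[OF x] perron_iff_multiple[OF x]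
  by (auto simp: DM0_def doubling_measures_eq C0_graph_eq[OF x])

end

section \<open>Matrices indexed by vertex lists\<close>

text \<open>Distinctness lets an index be recovered from its vertex, so every vector comes from a
  function of vertices.\<close>

lemma vec_as_function:
  assumes "distinct vs" "dim_vec x = length vs"
  obtains f where "x = vec (length vs) (\<lambda>i. f (vs ! i))"
proof -
  have "inj_on ((!) vs) {..<length vs}" using assms by (simp add: inj_on_nth)
  then have "x = vec (length vs) (\<lambda>i. (\<lambda>v. x $ inv_into {..<length vs} ((!) vs) v) (vs ! i))"
    using assms by (intro eq_vecI) (auto simp: inv_into_f_f)
  then show thesis by (rule that)
qed

text \<open>Reindexing along the bijection from positions to vertices turns rows into sums over
  \<open>set vs\<close>. The general ring serves both the real matrix and its complex copy.\<close>

lemma eigenvector_mat_iff: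
  fixes f :: "'a \<Rightarrow> 'b::comm_ring_1"
  assumes "distinct vs"
  shows "eigenvector (mat (length vs) (length vs) (\<lambda>(i, j). b (vs ! i) (vs ! j)))
      (vec (length vs) (\<lambda>i. f (vs ! i))) k \<longleftrightarrow>
    (\<exists>v\<in>set vs. f v \<noteq> 0) \<and> (\<forall>v\<in>set vs. (\<Sum>w\<in>set vs. b v w * f w) = k * f v)"
proof -
  define n where "n = length vs"
  define A where "A = mat n n (\<lambda>(i, j). b (vs ! i) (vs ! j))"
  define x where "x = vec n (\<lambda>i. f (vs ! i))"
  have all: "(\<forall>v\<in>set vs. P v) \<longleftrightarrow> (\<forall>i<n. P (vs ! i))" for P
    by (simp add: all_set_conv_all_nth n_def)
  have "(A *\<^sub>v x) $ i = (\<Sum>w\<in>set vs. b (vs ! i) w * f w)" if "i < n" for i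
  proof -
    have "(A *\<^sub>v x) $ i = (\<Sum>j\<in>{..<n}. b (vs ! i) (vs ! j) * f (vs ! j))"
      using that by (simp add: A_def x_def scalar_prod_def lessThan_atLeast0)
    also have "\<dots> = (\<Sum>w\<in>set vs. b (vs ! i) w * f w)"
      using bij_betw_nth[OF assms, of "{..<n}" "set vs"]
      by (intro sum.reindex_bij_betw) (simp add: n_def)
    finally show ?thesis .
  qed
  then have "A *\<^sub>v x = k \<cdot>\<^sub>v x \<longleftrightarrow> (\<forall>v\<in>set vs. (\<Sum>w\<in>set vs. b v w * f w) = k * f v)"
    unfolding all by (auto simp: vec_eq_iff A_def x_def)
  moreover have "x \<noteq> 0\<^sub>v n \<longleftrightarrow> \<not> (\<forall>v\<in>set vs. f v = 0)"
    unfolding all by (auto simp: vec_eq_iff x_def)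
  ultimately show ?thesis
    by (auto simp: eigenvector_def A_def x_def n_def)
qed

section \<open>Spectrum of the adjacency matrix in terms of eigenfunctions\<close>

context finite_graph
begin

lemma eigenvector_adjacency_iff:
  assumes "distinct vs" "set vs = V"
  shows "eigenvector (adjacency_matrix E vs) (vec (length vs) (\<lambda>i. f (vs ! i))) k \<longleftrightarrow>
    (\<exists>v\<in>V. f v \<noteq> 0) \<and> eigenfunction k f"
  using eigenvector_mat_iff[OF assms(1), of "\<lambda>v w. if {v, w} \<in> E then 1 else 0" f k]
  by (simp add: adjacency_matrix_def eigenfunction_def app_def assms(2))

lemma eigenvector_complex_adjacency_iff:
  assumes "distinct vs" "set vs = V"
  shows "eigenvector (map_mat complex_of_real (adjacency_matrix E vs))
      (vec (length vs) (\<lambda>i. f (vs ! i))) k \<longleftrightarrow>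
    (\<exists>v\<in>V. f v \<noteq> 0) \<and>
    (\<forall>v\<in>V. (\<Sum>w\<in>V. of_real (if {v, w} \<in> E then 1 else 0) * f w) = k * f v)"
proof -
  have "map_mat complex_of_real (adjacency_matrix E vs) = mat (length vs) (length vs)
      (\<lambda>(i, j). of_real (if {vs ! i, vs ! j} \<in> E then 1 else 0))"
    by (rule eq_matI) (auto simp: adjacency_matrix_def)
  then show ?thesis
    using eigenvector_mat_iff[OF assms(1), of "\<lambda>v w. of_real (if {v, w} \<in> E then 1 else 0)" f k]
    by (simp only: assms(2))
qed

lemma complex_eigenfunction_of_real:
  assumes "eigenfunction k f" "v \<in> V"
  shows "(\<Sum>w\<in>V. of_real (if {v, w} \<in> E then 1 else 0) * complex_of_real (f w))
    = of_real k * of_real (f v)"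
proof -
  have "complex_of_real (app f v) = of_real (k * f v)"
    using assms by (simp add: eigenfunction_def)
  then show ?thesis by (simp only: app_def of_real_sum of_real_mult)
qed

text \<open>The function \<open>x\<close>, read as a complex eigenvector, puts \<open>\<rho>\<close>
  into the spectrum; conversely the spectral radius is the modulus of some eigenvalue, which
  \<open>cmod_eigenvalue_le\<close> bounds by \<open>\<rho>\<close>.\<close>

lemma real_spectral_radius_adjacency:
  assumes x: "perron \<rho> x" and vs: "distinct vs" "set vs = V"
  shows "real_spectral_radius (adjacency_matrix E vs) = \<rho>"
proof -
  define A where "A = map_mat complex_of_real (adjacency_matrix E vs)"
  have A: "A \<in> carrier_mat (length vs) (length vs)"
    by (simp add: A_def adjacency_matrix_def)
  have pos: "0 < length vs" using vs V_nonempty by auto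
  obtain u where u: "u \<in> V" using V_nonempty by blast
  have "eigenvector A (vec (length vs) (\<lambda>i. complex_of_real (x (vs ! i)))) (of_real \<rho>)"
    unfolding A_def
    using eigenvector_complex_adjacency_iff[OF vs, of "\<lambda>v. complex_of_real (x v)" "of_real \<rho>"]
      complex_eigenfunction_of_real x u by (force simp: perron_def)
  then have "complex_of_real \<rho> \<in> spectrum A"
    by (auto simp: spectrum_def eigenvalue_def)
  then have "cmod (complex_of_real \<rho>) \<le> spectral_radius A"
    using spectral_radius_mem_max(2)[OF A pos] by blast
  moreover have "spectral_radius A \<le> \<rho>"
  proof -
    obtain k where k: "k \<in> spectrum A" "spectral_radius A = cmod k"
      using spectral_radius_mem_max(1)[OF A pos] by blast
    then obtain z where z: "eigenvector A z k" by (auto simp: spectrum_def eigenvalue_def)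
    then have "dim_vec z = length vs" using A by (auto simp: eigenvector_def)
    then obtain f where "z = vec (length vs) (\<lambda>i. f (vs ! i))"
      using vec_as_function[OF vs(1)] by blast
    then show ?thesis
      using z cmod_eigenvalue_le[OF x, of _ f k] k(2)
      unfolding A_def by (auto simp: eigenvector_complex_adjacency_iff[OF vs])
  qed
  ultimately show ?thesis by (simp add: real_spectral_radius_def A_def)
qed

lemma eigenvalue_adjacency_le:
  assumes x: "perron \<rho> x" and vs: "distinct vs" "set vs = V"
    and k: "eigenvalue (adjacency_matrix E vs) k"
  shows "k \<le> \<rho>"
proof -
  obtain y where y: "eigenvector (adjacency_matrix E vs) y k"
    using k by (auto simp: eigenvalue_def)
  then have "dim_vec y = length vs" by (auto simp: eigenvector_def adjacency_matrix_def)
  then obtain f where "y = vec (length vs) (\<lambda>i. f (vs ! i))"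
    using vec_as_function[OF vs(1)] by blast
  then obtain u where "u \<in> V" "f u \<noteq> 0" "eigenfunction k f"
    using y by (auto simp: eigenvector_adjacency_iff[OF vs])
  then have "cmod (of_real k) \<le> \<rho>"
    using cmod_eigenvalue_le[OF x, of u "\<lambda>v. of_real (f v)" "of_real k"]
      complex_eigenfunction_of_real by simp
  then show ?thesis by simp
qed

text \<open>The given \<open>x\<close> identifies the spectral radius with \<open>\<rho>\<close>;
  positivity of \<open>f\<close> then takes care of the nonzero condition on eigenvectors.\<close>

lemma perron_eigenvector_iff:
  assumes x: "perron \<rho> x" and vs: "distinct vs" "set vs = V"
  shows "perron_eigenvector (adjacency_matrix E vs) (vec (length vs) (\<lambda>i. f (vs ! i)))
    \<longleftrightarrow> perron \<rho> f"
proof -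
  have "(\<forall>i<length vs. 0 < f (vs ! i)) \<longleftrightarrow> (\<forall>v\<in>V. 0 < f v)"
    by (simp add: vs(2)[symmetric] all_set_conv_all_nth)
  moreover have "\<exists>v\<in>V. f v \<noteq> 0" if "\<forall>v\<in>V. 0 < f v"
    using that V_nonempty by force
  ultimately show ?thesis
    by (auto simp: perron_eigenvector_def perron_def eigenvector_adjacency_iff[OF vs]
        real_spectral_radius_adjacency[OF x vs])
qed

end

theorem theorem3p1:
  fixes V :: "'a set" and E :: "'a set set" and vs :: "'a list"
  assumes "graph V E" and "finite V"
    and "distinct vs" and "set vs = V"
  shows "let A = adjacency_matrix E vs; r = real_spectral_radius A in
    C0_graph V E = ereal (1 + r) \<and>
    eigenvalue A r \<and> (\<forall>k. eigenvalue A k \<longrightarrow> k \<le> r) \<and>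
    (\<exists>x. perron_eigenvector A x) \<and>
    (\<forall>x. perron_eigenvector A x \<longrightarrow>
      DM0 V E = {\<mu> \<in> measures_on V. \<exists>c>0. \<forall>i<length vs. \<mu> (vs ! i) = c * x $ i})"
proof -
  interpret finite_graph V E
    using assms by (simp add: finite_graph_def finite_graph_axioms_def)
  note vs = assms(3,4)
  define A where "A = adjacency_matrix E vs"
  obtain \<rho> x where x: "perron \<rho> x" by (rule perron_exists)
  have r: "real_spectral_radius A = \<rho>"
    unfolding A_def by (rule real_spectral_radius_adjacency[OF x vs])
  have ex: "perron_eigenvector A (vec (length vs) (\<lambda>i. x (vs ! i)))"
    unfolding A_def using x perron_eigenvector_iff[OF x vs] by blast
  then have ev: "eigenvalue A \<rho>"
    by (auto simp: perron_eigenvector_def eigenvalue_def r)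
  \<comment> \<open>An arbitrary Perron eigenvector \<open>y\<close> is read as a function
    \<open>f\<close> of vertices, and \<open>DM0_eq\<close> is applied to \<open>f\<close> in place
    of \<open>x\<close>.\<close>
  have "DM0 V E = {\<mu> \<in> measures_on V. \<exists>c>0. \<forall>i<length vs. \<mu> (vs ! i) = c * y $ i}"
    if y: "perron_eigenvector A y" for y
  proof -
    have "dim_vec y = length vs"
      using y by (auto simp: perron_eigenvector_def eigenvector_def A_def adjacency_matrix_def)
    then obtain f where f: "y = vec (length vs) (\<lambda>i. f (vs ! i))"
      using vec_as_function[OF vs(1)] by blast
    then have "perron \<rho> f"
      using y perron_eigenvector_iff[OF x vs] by (simp add: A_def)
    moreover have "(\<forall>v\<in>V. \<mu> v = c * f v) \<longleftrightarrow> (\<forall>i<length vs. \<mu> (vs ! i) = c * y $ i)" for \<mu> c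
      by (simp add: f vs(2)[symmetric] all_set_conv_all_nth)
    ultimately show ?thesis by (simp add: DM0_eq)
  qed
  then show ?thesis
    using ex ev eigenvalue_adjacency_le[OF x vs] C0_graph_eq[OF x]
    unfolding Let_def A_def[symmetric] r by blast
qed

end
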